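(* Let $q\in\mathbb{C}$ with $|q|<1$, and define \[ S(q):=\sum_{n\ge 0}\frac{\left(q;q^2\right)^2_n\, q^{2n}}{\left(-q^2;q^2\right)_n}. \] Then \[ \left(\left(q^4;q^4\right)_{\infty}S(q)\right)\bigm| S_{2,0}=\sum_{n\ge 0}(-1)^nq^{6n^2+4n}\left(1+q^{4n+2}\right)\sum_{|j|\le n}(-1)^{j}q^{-2j^2}, \] where the inner sum runs over all integers $j$ with $|j|\le n$.
   Context: For $n\in\mathbb{N}_0\cup\{\infty\}$, $(a;q)_n:=\prod_{j=0}^{n-1}(1-aq^j)$ is the $q$-Pochhammer symbol, and $(a,b;q)_n:=(a;q)_n(b;q)_n$. For $N\in\mathbb{N}$ and $r\in\mathbb{Z}$, the sieving operator $S_{N,r}$ acts on a power series $f(q)=\sum_{n\ge0}c(n)q^n$ by $f(q)\bigm|S_{N,r}:=\sum_{n\equiv r \pmod N} c(n)q^n$. *)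

theory Defs
  imports "HOL-Analysis.Analysis"
begin

definition qpoch :: "complex \<Rightarrow> complex \<Rightarrow> nat \<Rightarrow> complex" where
  "qpoch a q n = (\<Prod>j<n. 1 - a * q ^ j)"

definition qpoch_inf :: "complex \<Rightarrow> complex \<Rightarrow> complex" where
  "qpoch_inf a q = (\<Prod>j. 1 - a * q ^ j)"

text \<open>Sieving operator S_{N,r}: f is identified with its power series
  sum c(n) q^n at 0, c(n) = f^(n)(0)/n!, and only the terms with
  n = r (mod N) are kept.\<close>
definition sieve :: "nat \<Rightarrow> int \<Rightarrow> (complex \<Rightarrow> complex) \<Rightarrow> complex \<Rightarrow> complex" where
  "sieve N r f q =
     (\<Sum>n. if int n mod int N = r mod int N then (deriv ^^ n) f 0 / fact n * q ^ n else 0)"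

definition S_series :: "complex \<Rightarrow> complex" where
  "S_series q = (\<Sum>n. (qpoch q (q^2) n)^2 * q^(2*n) / qpoch (-(q^2)) (q^2) n)"

end

theory Submission
  imports Defs "HOL-Complex_Analysis.Complex_Analysis"
begin

text \<open>
  Write \<open>Q = q\<^sup>2\<close>. Since \<open>(q\<^sup>4; q\<^sup>4)\<^sub>\<infinity>\<close> is even in \<open>q\<close>, only the even part of \<open>S\<close> matters. The finite Jacobi
  triple product expands \<open>(q; q\<^sup>2)\<^sub>n\<^sup>2\<close> as a sum over \<open>j\<close> of \<open>(-1)\<^sup>j q\<^bsup>j\<^sup>2\<^esup>\<close> times a function of \<open>Q\<close>, so the even
  part keeps the even \<open>j\<close>: it is the sum over all integers \<open>j\<close> of \<open>Q\<^bsup>2j\<^sup>2\<^esup> G(2j)\<close>, where \<open>G(L)\<close> is the sum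
  over \<open>n\<close> of \<open>Q\<^sup>n (Q; Q\<^sup>2)\<^sub>n (Q; Q)\<^sub>n / ((Q; Q)\<^bsub>n-L\<^esub> (Q; Q)\<^bsub>n+L\<^esub>)\<close>. Telescoping in \<open>n\<close> gives
  \<open>G(L) + Q\<^bsup>3L+3\<^esup> G(L+2) = Q\<^sup>L (1 + Q\<^bsup>L+1\<^esup>) / (Q\<^sup>2; Q\<^sup>2)\<^sub>\<infinity>\<close>. Iterating this recurrence along \<open>L = 2j\<close> expresses
  \<open>G(2j)\<close> as a partial theta series over \<open>n \<ge> |j|\<close>, and exchanging the sums over \<open>j\<close> and \<open>n\<close> gives the
  right-hand side.
\<close>

section \<open>$q$-Pochhammer symbols\<close>

lemma qpoch_0 [simp]: "qpoch a q 0 = 1"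
  by (simp add: qpoch_def)

lemma qpoch_Suc: "qpoch a q (Suc n) = qpoch a q n * (1 - a * q ^ n)"
  by (simp add: qpoch_def)

lemma convergent_prod_qpoch:
  fixes a q :: complex
  assumes "norm q < 1"
  shows "convergent_prod (\<lambda>j. 1 - a * q ^ j)"
proof -
  have "summable (\<lambda>j. norm (a * q ^ j))"
    using assms by (auto simp: norm_mult norm_power intro!: summable_mult summable_geometric)
  then show ?thesis
    by (intro abs_convergent_prod_imp_convergent_prod summable_imp_abs_convergent_prod)
       (simp add: norm_minus_commute)
qed

lemma qpoch_tendsto:
  assumes "norm q < 1"
  shows "(\<lambda>n. qpoch a q n) \<longlonglongrightarrow> qpoch_inf a q"
  using convergent_prod_LIMSEQ[OF convergent_prod_qpoch[OF assms, of a]]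
  unfolding qpoch_inf_def qpoch_def
  by (simp add: LIMSEQ_lessThan_iff_atMost)

lemma one_minus_mult_power_nonzero:
  fixes a q :: complex
  assumes "norm q < 1" "norm a < 1"
  shows "1 - a * q ^ j \<noteq> 0"
proof
  assume "1 - a * q ^ j = 0"
  then have "norm (a * q ^ j) = 1" by (metis eq_iff_diff_eq_0 norm_one)
  moreover have "norm a * norm q ^ j \<le> norm a * 1"
    using assms by (intro mult_left_mono power_le_one) auto
  ultimately show False using assms by (simp add: norm_mult norm_power)
qed

lemma qpoch_nonzero:
  assumes "norm q < 1" "norm a < 1"
  shows "qpoch a q n \<noteq> 0"
  using one_minus_mult_power_nonzero[OF assms] by (simp add: qpoch_def)

lemma qpoch_inf_nonzero:
  assumes "norm q < 1" "norm a < 1"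
  shows "qpoch_inf a q \<noteq> 0"
  unfolding qpoch_inf_def
  using one_minus_mult_power_nonzero[OF assms] convergent_prod_qpoch[OF assms(1)]
  by (intro prodinf_nonzero) auto

lemma qpoch_mult_minus: "qpoch a q n * qpoch (- a) q n = qpoch (a\<^sup>2) (q\<^sup>2) n"
proof -
  have "(1 - a * q ^ j) * (1 - (- a) * q ^ j) = 1 - a\<^sup>2 * (q\<^sup>2) ^ j" for j
    by (simp add: algebra_simps power2_eq_square power_mult_distrib)
  then show ?thesis
    unfolding qpoch_def by (simp flip: prod.distrib)
qed

text \<open>The factors of \<open>qpoch q q (2 * n)\<close> are sorted by the parity of their
  exponent.\<close>

lemma qpoch_double: "qpoch q (q\<^sup>2) n * qpoch (q\<^sup>2) (q\<^sup>2) n = qpoch q q (2 * n)"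
proof (induction n)
  case (Suc n)
  have "qpoch q q (2 * Suc n) = qpoch q q (2 * n) * (1 - q * q ^ (2 * n)) * (1 - q * q ^ Suc (2 * n))"
    by (simp add: qpoch_Suc)
  also have "\<dots> = qpoch q (q\<^sup>2) (Suc n) * qpoch (q\<^sup>2) (q\<^sup>2) (Suc n)"
    unfolding Suc[symmetric] qpoch_Suc
    by (simp add: power_mult power2_eq_square power_mult_distrib mult_ac)
  finally show ?case by simp
qed simp

text \<open>The extension by zero to negative indices gives the coefficients below finite support in
  \<open>j\<close> and \<open>L\<close> and removes case distinctions at the ends of sums.\<close>

definition inv_qpoch :: "complex \<Rightarrow> int \<Rightarrow> complex" where
  "inv_qpoch q m = (if m < 0 then 0 else 1 / qpoch q q (nat m))"

lemma inv_qpoch_neg [simp]: "m < 0 \<Longrightarrow> inv_qpoch q m = 0"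
  by (simp add: inv_qpoch_def)

lemma inv_qpoch_0 [simp]: "inv_qpoch q 0 = 1"
  by (simp add: inv_qpoch_def)

text \<open>At \<open>m = 0\<close> the factor \<open>1 - q powi m\<close> vanishes, in agreement
  with the extension by zero, so one recurrence covers every integer index.\<close>

lemma inv_qpoch_diff_one:
  assumes "norm q < 1"
  shows "inv_qpoch q (m - 1) = (1 - q powi m) * inv_qpoch q m"
proof (cases "m > 0")
  case True
  define k where "k = nat (m - 1)"
  have m: "m = int (Suc k)" "m - 1 = int k" using True by (auto simp: k_def)
  have "qpoch q q (Suc k) \<noteq> 0" by (rule qpoch_nonzero) (use assms in auto)
  then show ?thesis
    unfolding m inv_qpoch_def by (simp add: qpoch_Suc power_int_def nat_add_distrib)
next
  case False
  then show ?thesis by (cases "m = 0") auto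
qed

lemma inv_qpoch_tendsto:
  assumes "norm q < 1"
  shows "(\<lambda>n. inv_qpoch q (int n + m)) \<longlonglongrightarrow> 1 / qpoch_inf q q"
proof -
  have lim: "(\<lambda>n. 1 / qpoch q q n) \<longlonglongrightarrow> 1 / qpoch_inf q q"
    by (intro tendsto_intros qpoch_tendsto qpoch_inf_nonzero assms)
  have "filterlim (\<lambda>n. nat (int n + m)) at_top sequentially"
    unfolding filterlim_at_top
  proof
    fix Z
    show "eventually (\<lambda>n. Z \<le> nat (int n + m)) sequentially"
      using eventually_ge_at_top[of "Z + nat \<bar>m\<bar>"] by eventually_elim linarith
  qed
  from filterlim_compose[OF lim this]
  show ?thesis
  proof (rule Lim_transform_eventually)
    show "\<forall>\<^sub>F n in sequentially. 1 / qpoch q q (nat (int n + m)) = inv_qpoch q (int n + m)"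
      using eventually_ge_at_top[of "nat \<bar>m\<bar>"]
      by eventually_elim (auto simp: inv_qpoch_def)
  qed
qed

lemma inv_qpoch_bounded:
  assumes "norm q < 1"
  obtains B where "\<And>m. norm (inv_qpoch q m) \<le> B"
proof -
  have "Bseq (\<lambda>n. inv_qpoch q (int n))"
    using inv_qpoch_tendsto[OF assms, of 0] by (auto intro!: convergent_imp_Bseq convergentI)
  then obtain B where B: "B > 0" "\<And>n. norm (inv_qpoch q (int n)) \<le> B"
    by (auto simp: Bseq_def)
  have "norm (inv_qpoch q m) \<le> B" for m
  proof (cases "m < 0")
    case False
    then show ?thesis using B(2)[of "nat m"] by simp
  qed (use B in auto)
  then show ?thesis by (rule that)
qed

section \<open>The finite Jacobi triple product at $x = 1$\<close>

text \<open>This is the Gaussian binomial coefficient of \<open>2 * n\<close> over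
  \<open>n - j\<close> in base \<open>q^2\<close>.\<close>

definition jtp_coeff :: "complex \<Rightarrow> nat \<Rightarrow> int \<Rightarrow> complex" where
  "jtp_coeff q n j = qpoch (q\<^sup>2) (q\<^sup>2) (2 * n) *
     inv_qpoch (q\<^sup>2) (int n - j) * inv_qpoch (q\<^sup>2) (int n + j)"

lemma jtp_coeff_eq_0: "int n < \<bar>j\<bar> \<Longrightarrow> jtp_coeff q n j = 0"
  by (cases "j \<ge> 0") (auto simp: jtp_coeff_def)

text \<open>Up to signs, this compares coefficients of \<open>x^j\<close> when the finite triple
  product in \<open>x\<close> is multiplied by
  \<open>(1 - x q^(2n+1)) (1 - q^(2n+1) / x)\<close>.\<close>

lemma jtp_coeff_Suc:
  assumes "norm q < 1" "q \<noteq> 0"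
  shows "q powi (j\<^sup>2) * jtp_coeff q (Suc n) j =
    (1 + q ^ (4 * n + 2)) * (q powi (j\<^sup>2) * jtp_coeff q n j) +
    q ^ (2 * n + 1) * (q powi ((j - 1)\<^sup>2) * jtp_coeff q n (j - 1) + q powi ((j + 1)\<^sup>2) * jtp_coeff q n (j + 1))"
proof -
  define Q where "Q = q\<^sup>2"
  have Q: "norm Q < 1" "Q \<noteq> 0" using assms by (auto simp: Q_def norm_power power_less_one_iff)
  define a where "a = Q ^ n"
  define z where "z = Q powi j"
  have z: "z \<noteq> 0" using Q by (simp add: z_def)
  \<comment> \<open>\<open>u\<close> and \<open>v\<close> have the largest indices that occur, so
    \<open>inv_qpoch_diff_one\<close> makes every other reciprocal an explicit multiple of one of
    them.\<close>
  define u where "u = inv_qpoch Q (int n - j + 1)"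
  define v where "v = inv_qpoch Q (int n + j + 1)"
  have pQ: "Q powi (int n - j + 1) = Q * a / z" "Q powi (int n - j) = a / z"
    "Q powi (int n + j + 1) = Q * a * z" "Q powi (int n + j) = a * z"
    using Q by (auto simp: a_def z_def power_int_add power_int_diff)
  have u1: "inv_qpoch Q (int n - j) = (1 - Q * a / z) * u"
    using inv_qpoch_diff_one[OF Q(1), of "int n - j + 1"] unfolding pQ u_def by simp
  have u2: "inv_qpoch Q (int n - (j + 1)) = (1 - a / z) * (1 - Q * a / z) * u"
    using inv_qpoch_diff_one[OF Q(1), of "int n - j"] unfolding pQ u1 by (simp add: algebra_simps)
  have v1: "inv_qpoch Q (int n + j) = (1 - Q * a * z) * v"
    using inv_qpoch_diff_one[OF Q(1), of "int n + j + 1"] unfolding pQ v_def by simp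
  have v2: "inv_qpoch Q (int n + (j - 1)) = (1 - a * z) * (1 - Q * a * z) * v"
    using inv_qpoch_diff_one[OF Q(1), of "int n + j"] unfolding pQ v1 by (simp add: algebra_simps)
  have u0: "inv_qpoch Q (int n - (j - 1)) = u" "inv_qpoch Q (int (Suc n) - j) = u"
    by (auto simp: u_def algebra_simps)
  have v0: "inv_qpoch Q (int n + (j + 1)) = v" "inv_qpoch Q (int (Suc n) + j) = v"
    by (auto simp: v_def algebra_simps)
  have z': "z = (q powi j)\<^sup>2" by (simp add: z_def Q_def power_int_power' power_int_power mult.commute)
  have zj: "q powi (j + j) = z" unfolding z' power2_eq_square by (rule power_int_add) (use assms in auto)
  have e1: "q powi ((j - 1)\<^sup>2) = q powi (j\<^sup>2) * q / z"
  proof -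
    have *: "(j - 1)\<^sup>2 = j\<^sup>2 + 1 - (j + j)" by (simp add: power2_eq_square algebra_simps)
    have "q powi ((j - 1)\<^sup>2) = q powi (j\<^sup>2 + 1) / q powi (j + j)"
      unfolding * by (rule power_int_diff) (use assms in auto)
    then show ?thesis using assms unfolding zj by (simp add: power_int_add)
  qed
  have e2: "q powi ((j + 1)\<^sup>2) = q powi (j\<^sup>2) * q * z"
  proof -
    have *: "(j + 1)\<^sup>2 = j\<^sup>2 + 1 + (j + j)" by (simp add: power2_eq_square algebra_simps)
    have "q powi ((j + 1)\<^sup>2) = q powi (j\<^sup>2 + 1) * q powi (j + j)"
      unfolding * by (rule power_int_add) (use assms in auto)
    then show ?thesis using assms unfolding zj by (simp add: power_int_add)
  qed
  have e3: "q ^ (4 * n + 2) = Q * a\<^sup>2" "q ^ (2 * n + 1) * q = Q * a"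
    by (auto simp: Q_def a_def power_add power_mult power2_eq_square power4_eq_xxxx power_mult_distrib)
  have A: "qpoch Q Q (2 * Suc n) = qpoch Q Q (2 * n) * (1 - Q * a\<^sup>2) * (1 - Q\<^sup>2 * a\<^sup>2)"
  proof -
    have "Q ^ (2 * n) = a\<^sup>2" by (simp add: a_def power_mult mult.commute flip: power_mult)
    then show ?thesis by (simp add: qpoch_Suc power2_eq_square mult_ac)
  qed
  \<comment> \<open>This rational identity is what is left of the recurrence after the common
    factor, called \<open>w\<close> below, is taken out.\<close>
  have key: "(1 - Q * a\<^sup>2) * (1 - Q\<^sup>2 * a\<^sup>2) =
     (1 + Q * a\<^sup>2) * (1 - Q * a / z) * (1 - Q * a * z)
      + Q * a / z * (1 - a * z) * (1 - Q * a * z) + Q * a * z * (1 - a / z) * (1 - Q * a / z)"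
    using z by (simp add: field_simps power2_eq_square)
  have distr: "w * (s * A * B + Q * a / z * C * B + Q * a * z * D * A) =
      s * (w * A * B) + (Q * a) * (w / z * C * B + w * z * D * A)" for w s A B C D :: complex
    by (simp add: algebra_simps)
  define w where "w = q powi (j\<^sup>2) * qpoch Q Q (2 * n) * u * v"
  have "q powi (j\<^sup>2) * jtp_coeff q (Suc n) j = w * ((1 - Q * a\<^sup>2) * (1 - Q\<^sup>2 * a\<^sup>2))"
    unfolding jtp_coeff_def Q_def[symmetric] A u0 v0 w_def by (simp add: mult_ac)
  also have "\<dots> = (1 + Q * a\<^sup>2) * (w * (1 - Q * a / z) * (1 - Q * a * z))
      + (Q * a) * (w / z * (1 - a * z) * (1 - Q * a * z) + w * z * (1 - a / z) * (1 - Q * a / z))"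
    unfolding key by (rule distr)
  also have "\<dots> = (1 + Q * a\<^sup>2) * (q powi (j\<^sup>2) * jtp_coeff q n j) + (q ^ (2 * n + 1) * q) *
     (q powi (j\<^sup>2) / z * jtp_coeff q n (j - 1) + q powi (j\<^sup>2) * z * jtp_coeff q n (j + 1))"
    unfolding jtp_coeff_def Q_def[symmetric] u0 v0 u1 u2 v1 v2 w_def e3 by (simp add: mult_ac)
  finally show ?thesis
    unfolding e1 e2 e3(1) by (simp add: mult_ac distrib_left)
qed

lemma sum_int_shift:
  fixes f :: "int \<Rightarrow> complex"
  shows "(\<Sum>j=a..b. f (j + k)) = (\<Sum>j=a+k..b+k. f j)"
  by (rule sum.reindex_bij_witness[of _ "\<lambda>j. j - k" "\<lambda>j. j + k"]) auto

text \<open>In the induction both sides acquire the factor \<open>(1 - q^(2n+1))^2\<close>, by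
  \<open>jtp_coeff_Suc\<close> on the right. Leaving \<open>M\<close> free keeps the range of
  summation fixed from \<open>n\<close> to \<open>n + 1\<close>.\<close>

lemma finite_jacobi_triple_product_1:
  assumes "norm q < 1" "q \<noteq> 0" "int n \<le> M"
  shows "(qpoch q (q\<^sup>2) n)\<^sup>2 = (\<Sum>j=-M..M. (-1) powi j * q powi (j\<^sup>2) * jtp_coeff q n j)"
  using assms(3)
proof (induction n arbitrary: M)
  case 0
  have "(\<Sum>j=-M..M. (-1) powi j * q powi (j\<^sup>2) * jtp_coeff q 0 j) =
     (\<Sum>j\<in>{0}. (-1) powi j * q powi (j\<^sup>2) * jtp_coeff q 0 j)"
    by (rule sum.mono_neutral_right) (use 0 in \<open>auto simp: jtp_coeff_eq_0\<close>)
  then show ?case by (simp add: jtp_coeff_def)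
next
  case (Suc n)
  define c where "c j = (-1) powi j * q powi (j\<^sup>2) * jtp_coeff q n j" for j
  have c0: "c j = 0" if "int n < \<bar>j\<bar>" for j using that by (simp add: c_def jtp_coeff_eq_0)
  \<comment> \<open>The alternating sign turns the neighbouring terms negative; writing
    \<open>j + (-1)\<close> lets \<open>shift\<close> treat both neighbours.\<close>
  have rec: "(-1) powi j * q powi (j\<^sup>2) * jtp_coeff q (Suc n) j =
     (1 + q ^ (4 * n + 2)) * c j - q ^ (2 * n + 1) * (c (j + (-1)) + c (j + 1))" for j
  proof -
    have *: "(-1) powi (j - 1) = -((-1) powi j :: complex)" "(-1) powi (j + 1) = -((-1) powi j :: complex)"
      "(-1) powi (1 + j) = -((-1) powi j :: complex)"
      by (auto simp: power_int_diff power_int_add)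
    show ?thesis
      unfolding mult.assoc jtp_coeff_Suc[OF assms(1,2)] c_def
      unfolding * by (simp add: * algebra_simps del: power_int_add_1 power_int_add_1')
  qed
  \<comment> \<open>Since \<open>c\<close> is supported on \<open>\<bar>j\<bar> \<le> n < M\<close>,
    a shift by one moves only zero terms across the ends.\<close>
  have shift: "(\<Sum>j=-M..M. c (j + k)) = (\<Sum>j=-M..M. c j)" if "\<bar>k\<bar> = 1" for k
    unfolding sum_int_shift
    by (rule sum.mono_neutral_cong) (use Suc.prems that in \<open>auto intro!: c0\<close>)
  have "(\<Sum>j=-M..M. (-1) powi j * q powi (j\<^sup>2) * jtp_coeff q (Suc n) j) =
     (1 + q ^ (4 * n + 2)) * (\<Sum>j=-M..M. c j)
       - q ^ (2 * n + 1) * ((\<Sum>j=-M..M. c (j + (-1))) + (\<Sum>j=-M..M. c (j + 1)))"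
    unfolding rec by (simp only: sum_subtractf sum.distrib flip: sum_distrib_left)
  also have "\<dots> = (1 + q ^ (4 * n + 2) - 2 * q ^ (2 * n + 1)) * (\<Sum>j=-M..M. c j)"
    using shift[of "-1"] shift[of 1] by (simp add: algebra_simps)
  also have "(\<Sum>j=-M..M. c j) = (qpoch q (q\<^sup>2) n)\<^sup>2"
    unfolding c_def by (rule Suc.IH[symmetric]) (use Suc.prems in simp)
  also have "(1 + q ^ (4 * n + 2) - 2 * q ^ (2 * n + 1)) = (1 - q * (q\<^sup>2) ^ n)\<^sup>2"
    by (simp add: power2_eq_square algebra_simps power_add power_mult power4_eq_xxxx power_mult_distrib)
  finally show ?case by (simp add: qpoch_Suc power_mult_distrib mult_ac)
qed

section \<open>A conjugate Bailey pair\<close>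

text \<open>A division-free form of \<open>(q;q)_(2n) / (-q;q)_n\<close>, the quotient that arises
  when the triple product is inserted into \<open>S\<close>.\<close>

definition qpoch_odd :: "complex \<Rightarrow> nat \<Rightarrow> complex" where
  "qpoch_odd q n = qpoch q (q\<^sup>2) n * qpoch q q n"

lemma qpoch_even_length: "qpoch q q (2 * n) = qpoch_odd q n * qpoch (- q) q n"
  by (simp add: qpoch_odd_def qpoch_mult_minus flip: qpoch_double mult.assoc)

lemma qpoch_odd_Suc:
  "qpoch_odd q (Suc n) = qpoch_odd q n * (1 - q * (q ^ n)\<^sup>2) * (1 - q * q ^ n)"
  by (simp add: qpoch_odd_def qpoch_Suc power2_eq_square power_mult_distrib)

lemma qpoch_inf_mult_minus:
  assumes "norm q < 1"
  shows "qpoch_inf q q * qpoch_inf (- q) q = qpoch_inf (q\<^sup>2) (q\<^sup>2)"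
proof (rule LIMSEQ_unique)
  show "(\<lambda>n. qpoch q q n * qpoch (- q) q n) \<longlonglongrightarrow> qpoch_inf q q * qpoch_inf (- q) q"
    by (intro tendsto_intros qpoch_tendsto assms)
  show "(\<lambda>n. qpoch q q n * qpoch (- q) q n) \<longlonglongrightarrow> qpoch_inf (q\<^sup>2) (q\<^sup>2)"
    unfolding qpoch_mult_minus
    by (intro qpoch_tendsto) (use assms in \<open>simp add: norm_power power_less_one_iff\<close>)
qed

lemma qpoch_odd_tendsto:
  assumes "norm q < 1"
  shows "qpoch_odd q \<longlonglongrightarrow> qpoch_inf q q / qpoch_inf (- q) q"
proof -
  have "(\<lambda>n. qpoch q q (2 * n)) \<longlonglongrightarrow> qpoch_inf q q"
    by (rule filterlim_compose[OF qpoch_tendsto[OF assms]])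
       (auto intro!: filterlim_subseq strict_monoI)
  then have "(\<lambda>n. qpoch q q (2 * n) / qpoch (- q) q n) \<longlonglongrightarrow> qpoch_inf q q / qpoch_inf (- q) q"
    by (intro tendsto_intros qpoch_tendsto qpoch_inf_nonzero) (use assms in auto)
  moreover have "qpoch q q (2 * n) / qpoch (- q) q n = qpoch_odd q n" for n
    unfolding qpoch_even_length using qpoch_nonzero[of q "-q" n] assms by simp
  ultimately show ?thesis by simp
qed

text \<open>The summand of \<open>gamma_L\<close> in a conjugate Bailey pair relative to 1, with
  \<open>delta_n = q^n (q;q^2)_n (q;q)_n\<close>.\<close>

definition conj_term :: "complex \<Rightarrow> nat \<Rightarrow> int \<Rightarrow> complex" where
  "conj_term q n L = q ^ n * qpoch_odd q n * inv_qpoch q (int n - L) * inv_qpoch q (int n + L)"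

lemma conj_term_minus [simp]: "conj_term q n (- L) = conj_term q n L"
  by (simp add: conj_term_def)

lemma conj_term_eq_0: "int n < \<bar>L\<bar> \<Longrightarrow> conj_term q n L = 0"
  by (cases "L \<ge> 0") (auto simp: conj_term_def)

text \<open>By \<open>qpoch_even_length\<close> in base \<open>x^2\<close>, the denominator of the
  \<open>n\<close>-th term of \<open>S\<close> cancels against the numerator of the Gaussian
  binomial.\<close>

lemma conj_term_jtp_coeff:
  assumes "norm x < 1"
  shows "x ^ (2 * n) / qpoch (- (x\<^sup>2)) (x\<^sup>2) n * jtp_coeff x n j = conj_term (x\<^sup>2) n j"
proof -
  have "qpoch (- (x\<^sup>2)) (x\<^sup>2) n \<noteq> 0"
    by (rule qpoch_nonzero) (use assms in \<open>auto simp: norm_power power_less_one_iff\<close>)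
  then show ?thesis
    by (simp add: jtp_coeff_def qpoch_even_length conj_term_def power_mult)
qed

text \<open>The Pochhammer factors converge and hence are bounded. Uniformity in \<open>L\<close> is
  what the later exchange of sums relies on.\<close>

lemma conj_term_bounded:
  assumes "norm q < 1"
  obtains K where "\<And>n L. norm (conj_term q n L) \<le> K * norm q ^ n" "K > 0"
proof -
  obtain B where B: "\<And>m. norm (inv_qpoch q m) \<le> B"
    using inv_qpoch_bounded[OF assms] by blast
  have "Bseq (qpoch_odd q)"
    using qpoch_odd_tendsto[OF assms] by (auto intro!: convergent_imp_Bseq convergentI)
  then obtain C where C: "C > 0" "\<And>n. norm (qpoch_odd q n) \<le> C"
    by (auto simp: Bseq_def)
  have "norm (inv_qpoch q 0) \<le> B" by (rule B)
  then have B1: "B \<ge> 1" by simp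
  have "norm (conj_term q n L) \<le> (C * B * B) * norm q ^ n" for n L
  proof -
    have "norm (conj_term q n L) = norm (qpoch_odd q n) * norm (inv_qpoch q (int n - L))
       * norm (inv_qpoch q (int n + L)) * norm q ^ n"
      by (simp add: conj_term_def norm_mult norm_power)
    also have "\<dots> \<le> (C * B * B) * norm q ^ n"
      using C B1 by (intro mult_mono B mult_nonneg_nonneg) auto
    finally show ?thesis .
  qed
  then show ?thesis by (rule that) (use C B1 in auto)
qed

text \<open>\<open>R\<close> is a creative-telescoping certificate; its form comes from the ansatz that its prefactor,
  here \<open>y * (1 + q * y)\<close>, is independent of \<open>n\<close>.\<close>

lemma conj_term_telescope:
  fixes q :: complex and L :: int
  assumes "norm q < 1" "q \<noteq> 0"
  defines "y \<equiv> q powi L"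
  defines "R \<equiv> \<lambda>n. y * (1 + q * y) * qpoch_odd q n *
                inv_qpoch q (int n + (- L - 1)) * inv_qpoch q (int n + (L + 1))"
  shows "conj_term q n L + q ^ 3 * y ^ 3 * conj_term q n (L + 2) = R (Suc n) - R n"
proof -
  define x where "x = q ^ n"
  have y: "y \<noteq> 0" using assms by (simp add: y_def)
  define u where "u = inv_qpoch q (int n - L)"
  define v where "v = inv_qpoch q (int n + L + 2)"
  define D where "D = qpoch_odd q n"
  have p: "q powi (int n - L) = x / y" "q powi (int n - L - 1) = x / (q * y)"
    "q powi (int n + L + 2) = q\<^sup>2 * x * y" "q powi (int n + L + 1) = q * x * y"
    using assms by (auto simp: x_def y_def power_int_add power_int_diff mult_ac)
  have u1: "inv_qpoch q (int n - L - 1) = (1 - x / y) * u"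
    using inv_qpoch_diff_one[OF assms(1), of "int n - L"] by (simp add: p u_def)
  have u2: "inv_qpoch q (int n - L - 2) = (1 - x / (q * y)) * (1 - x / y) * u"
    using inv_qpoch_diff_one[OF assms(1), of "int n - L - 1"] by (simp add: p u1)
  have v1: "inv_qpoch q (int n + L + 1) = (1 - q\<^sup>2 * x * y) * v"
    using inv_qpoch_diff_one[OF assms(1), of "int n + L + 2"] unfolding p v_def
    by (simp add: algebra_simps)
  have v2: "inv_qpoch q (int n + L) = (1 - q * x * y) * (1 - q\<^sup>2 * x * y) * v"
    using inv_qpoch_diff_one[OF assms(1), of "int n + L + 1"] by (simp add: p v1)
  have i: "int n - (L + 2) = int n - L - 2" "int n + (L + 2) = int n + L + 2"
    "int n + (- L - 1) = int n - L - 1" "int n + (L + 1) = int n + L + 1"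
    "int (Suc n) + (- L - 1) = int n - L" "int (Suc n) + (L + 1) = int n + L + 2" by auto
  \<comment> \<open>The certificate equation with \<open>D * u * v\<close> taken out, rational in
    \<open>q\<close>, \<open>x\<close> and \<open>y\<close>.\<close>
  have key: "x * (1 - q * x * y) * (1 - q\<^sup>2 * x * y) + q ^ 3 * y ^ 3 * x * (1 - x / (q * y)) * (1 - x / y) =
    y * (1 + q * y) * ((1 - q * x\<^sup>2) * (1 - q * x) - (1 - x / y) * (1 - q\<^sup>2 * x * y))"
    using y assms(2) by (simp add: field_simps) algebra
  have distr: "D * u * v * (c * (X * Y - A * B)) = c * (D * X * Y) * u * v - c * D * (A * u) * (B * v)"
    for c X Y A B :: complex
    by (simp add: algebra_simps)
  have "conj_term q n L + q ^ 3 * y ^ 3 * conj_term q n (L + 2) = D * u * v *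
    (x * (1 - q * x * y) * (1 - q\<^sup>2 * x * y) + q ^ 3 * y ^ 3 * x * (1 - x / (q * y)) * (1 - x / y))"
    unfolding conj_term_def i u2 v2 u_def[symmetric] v_def[symmetric] D_def[symmetric] x_def[symmetric]
    by (simp only: distrib_left mult_ac)
  also have "D * u * v * (x * (1 - q * x * y) * (1 - q\<^sup>2 * x * y)
      + q ^ 3 * y ^ 3 * x * (1 - x / (q * y)) * (1 - x / y)) = R (Suc n) - R n"
    unfolding key R_def i qpoch_odd_Suc u1 v1 u_def[symmetric] v_def[symmetric] D_def[symmetric] x_def[symmetric]
    by (rule distr)
  finally show ?thesis .
qed

section \<open>The sums \<open>G(L)\<close> of the outline and their recurrence\<close>

definition conj_sum :: "complex \<Rightarrow> int \<Rightarrow> complex" where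
  "conj_sum q L = (\<Sum>n. conj_term q n L)"

lemma summable_conj_term:
  assumes "norm q < 1"
  shows "summable (\<lambda>n. conj_term q n L)"
proof -
  obtain K where K: "\<And>n L. norm (conj_term q n L) \<le> K * norm q ^ n"
    using conj_term_bounded[OF assms] by blast
  show ?thesis
    by (rule summable_comparison_test'[OF _ K]) (use assms in \<open>auto intro!: summable_mult summable_geometric\<close>)
qed

lemma conj_sum_bounded:
  assumes "norm q < 1"
  obtains B where "\<And>L. norm (conj_sum q L) \<le> B"
proof -
  obtain K where K: "\<And>n L. norm (conj_term q n L) \<le> K * norm q ^ n"
    using conj_term_bounded[OF assms] by blast
  have s: "summable (\<lambda>n. K * norm q ^ n)" using assms by (auto intro!: summable_mult summable_geometric)
  show ?thesis
    by (rule that, unfold conj_sum_def, rule norm_suminf_le[OF K s])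
qed

text \<open>The telescoping identity is summed over \<open>n\<close>; the right-hand side is the
  limit of \<open>R\<close>, where \<open>qpoch_inf_mult_minus\<close> merges the infinite
  products.\<close>

lemma conj_sum_rec:
  fixes q :: complex and L :: int
  assumes "norm q < 1" "q \<noteq> 0" "L \<ge> 0"
  defines "y \<equiv> q powi L"
  shows "conj_sum q L + q ^ 3 * y ^ 3 * conj_sum q (L + 2) = y * (1 + q * y) / qpoch_inf (q\<^sup>2) (q\<^sup>2)"
proof -
  define R where "R n = y * (1 + q * y) * qpoch_odd q n *
      inv_qpoch q (int n + (- L - 1)) * inv_qpoch q (int n + (L + 1))" for n
  have "R \<longlonglongrightarrow> y * (1 + q * y) * (qpoch_inf q q / qpoch_inf (- q) q) * (1 / qpoch_inf q q) * (1 / qpoch_inf q q)"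
    unfolding R_def by (intro tendsto_intros qpoch_odd_tendsto inv_qpoch_tendsto assms)
  also have "y * (1 + q * y) * (qpoch_inf q q / qpoch_inf (- q) q) * (1 / qpoch_inf q q) * (1 / qpoch_inf q q)
     = y * (1 + q * y) / qpoch_inf (q\<^sup>2) (q\<^sup>2)"
    unfolding qpoch_inf_mult_minus[OF assms(1), symmetric]
    using qpoch_inf_nonzero[of q q] assms by (simp add: mult_ac)
  finally have "(\<lambda>n. R (Suc n) - R n) sums (y * (1 + q * y) / qpoch_inf (q\<^sup>2) (q\<^sup>2) - R 0)"
    by (rule telescope_sums)
  \<comment> \<open>For \<open>L \<ge> 0\<close> the index \<open>- L - 1\<close> is negative, so
    the lower boundary term vanishes.\<close>
  moreover have "R 0 = 0" using assms(3) by (simp add: R_def)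
  moreover have "R (Suc n) - R n = conj_term q n L + q ^ 3 * y ^ 3 * conj_term q n (L + 2)" for n
    unfolding R_def y_def by (rule conj_term_telescope[symmetric]) fact+
  ultimately have "(\<lambda>n. conj_term q n L + q ^ 3 * y ^ 3 * conj_term q n (L + 2)) sums
      (y * (1 + q * y) / qpoch_inf (q\<^sup>2) (q\<^sup>2))" by simp
  moreover have "(\<lambda>n. conj_term q n L + q ^ 3 * y ^ 3 * conj_term q n (L + 2)) sums
      (conj_sum q L + q ^ 3 * y ^ 3 * conj_sum q (L + 2))"
    unfolding conj_sum_def by (intro sums_add sums_mult summable_sums summable_conj_term assms)
  ultimately show ?thesis by (rule sums_unique2[symmetric])
qed

text \<open>By \<open>conj_sum_rec\<close> the factor outside the inner sum is a difference \<open>H n - H (n + 1)\<close>, so that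
  a summation by parts replaces the interchange of the two summations.\<close>

lemma indefinite_theta_sums:
  fixes q :: complex
  assumes "norm q < 1" "q \<noteq> 0"
    and lim: "(\<lambda>N. \<Sum>j\<in>{-int N<..<int N}. q powi (2 * j\<^sup>2) * conj_sum q (2 * j)) \<longlonglongrightarrow> l"
  shows "(\<lambda>n. (-1) ^ n * q ^ (3 * n\<^sup>2 + 2 * n) * (1 + q ^ (2 * n + 1)) *
       (\<Sum>j=-int n..int n. (-1) powi j * q powi (- (j\<^sup>2)))) sums (qpoch_inf (q\<^sup>2) (q\<^sup>2) * l)"
proof -
  define P where "P = qpoch_inf (q\<^sup>2) (q\<^sup>2)"
  have "P \<noteq> 0" unfolding P_def
    by (rule qpoch_inf_nonzero) (use assms in \<open>auto simp: norm_power power_less_one_iff\<close>)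
  \<comment> \<open>From \<open>n\<close> to \<open>n + 1\<close> the weight
    \<open>(-1)^n q^(3n^2)\<close> gains the factor \<open>- q^3 y^3\<close> with
    \<open>y = q^(2n)\<close>, which matches \<open>conj_sum_rec\<close> at
    \<open>L = 2n\<close>.\<close>
  define H where "H n = (-1) ^ n * q ^ (3 * n\<^sup>2) * (P * conj_sum q (2 * int n))" for n
  define a where "a n = (-1) ^ n * q ^ (3 * n\<^sup>2 + 2 * n) * (1 + q ^ (2 * n + 1))" for n
  define W where "W A = (\<Sum>j\<in>A. (-1) powi j * q powi (- (j\<^sup>2)))" for A :: "int set"
  \<comment> \<open>The open interval makes \<open>I 0\<close> empty and \<open>I (Suc n)\<close>
    the range \<open>\<bar>j\<bar> \<le> n\<close>.\<close>
  define I where "I N = {-int N<..<int N}" for N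
  have a: "a n = H n - H (Suc n)" for n
  proof -
    define y where "y = q ^ (2 * n)"
    have y: "q powi (2 * int n) = y" unfolding y_def
      by (metis of_nat_mult of_nat_numeral power_int_of_nat)
    have "conj_sum q (2 * int n) + q ^ 3 * y ^ 3 * conj_sum q (2 * int (Suc n)) = y * (1 + q * y) / P"
      using conj_sum_rec[OF assms(1,2), of "2 * int n"] unfolding y P_def by (simp add: algebra_simps)
    then have rec: "y * (1 + q * y) =
        P * conj_sum q (2 * int n) + q ^ 3 * y ^ 3 * (P * conj_sum q (2 * int (Suc n)))"
      using \<open>P \<noteq> 0\<close> by (simp add: field_simps)
    have "q ^ (3 * (Suc n)\<^sup>2) = q ^ (3 * n\<^sup>2) * (q ^ 3 * y ^ 3)"
      by (simp add: y_def power2_eq_square algebra_simps flip: power_mult power_add)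
    moreover have "a n = (-1) ^ n * q ^ (3 * n\<^sup>2) * (y * (1 + q * y))"
      by (simp add: a_def y_def power_add mult_ac)
    ultimately show ?thesis unfolding H_def rec by (simp add: algebra_simps)
  qed
  \<comment> \<open>For \<open>N = 0\<close> the added set is the singleton \<open>{0}\<close>, so
    the index zero is counted once.\<close>
  have I_Suc: "I (Suc N) = I N \<union> {int N, - int N}" "I N \<inter> {int N, - int N} = {}" "finite (I N)" for N
    by (auto simp: I_def)
  have I_W: "W (I (Suc n)) = (\<Sum>j=-int n..int n. (-1) powi j * q powi (- (j\<^sup>2)))" for n
    unfolding W_def by (rule sum.cong) (auto simp: I_def)
  have parts: "(\<Sum>n<N. a n * W (I (Suc n))) =
      P * (\<Sum>j\<in>I N. q powi (2 * j\<^sup>2) * conj_sum q (2 * j)) - H N * W (I N)" for N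
  proof (induction N)
    case 0
    then show ?case by (simp add: I_def W_def)
  next
    case (Suc N)
    have c: "conj_sum q (- (2 * int N)) = conj_sum q (2 * int N)"
      by (simp add: conj_sum_def)
    \<comment> \<open>At \<open>\<bar>j\<bar> = N\<close> the exponents combine to
      \<open>3N^2 - N^2 = 2N^2\<close> and the signs cancel, so the new terms of the inner sum yield
      theta summands.\<close>
    have "H N * ((-1) powi j * q powi (- (j\<^sup>2))) = P * (q powi (2 * j\<^sup>2) * conj_sum q (2 * j))"
      if "j \<in> {int N, - int N}" for j
    proof -
      have j2: "j\<^sup>2 = int (N\<^sup>2)" using that by auto
      have "q powi (2 * j\<^sup>2) = q ^ (2 * N\<^sup>2)"
        unfolding j2 by (metis of_nat_mult of_nat_numeral power_int_of_nat)
      moreover have "q powi (- (j\<^sup>2)) = inverse (q ^ N\<^sup>2)"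
        unfolding j2 by (simp only: power_int_minus power_int_of_nat)
      moreover have "conj_sum q (2 * j) = conj_sum q (2 * int N)"
        using that c by auto
      moreover have "(-1) powi j = ((-1) ^ N :: complex)"
        using that by (cases "even N") (auto simp: power_int_minus)
      moreover have "q ^ (3 * N\<^sup>2) = q ^ (2 * N\<^sup>2) * q ^ (N\<^sup>2)"
        by (simp flip: power_add)
      moreover have "(-1) ^ N * (-1) ^ N = (1::complex)" by (simp flip: power_mult_distrib)
      ultimately show ?thesis unfolding H_def using assms(2)
        by (simp add: field_simps)
    qed
    then have "H N * W {int N, - int N} = P * (\<Sum>j\<in>{int N, - int N}. q powi (2 * j\<^sup>2) * conj_sum q (2 * j))"
      unfolding W_def sum_distrib_left by (intro sum.cong refl)
    moreover have "W (I (Suc N)) = W (I N) + W {int N, - int N}"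
      unfolding I_Suc(1) W_def by (rule sum.union_disjoint) (use I_Suc in auto)
    moreover have "(\<Sum>j\<in>I (Suc N). q powi (2 * j\<^sup>2) * conj_sum q (2 * j)) =
      (\<Sum>j\<in>I N. q powi (2 * j\<^sup>2) * conj_sum q (2 * j)) + (\<Sum>j\<in>{int N, - int N}. q powi (2 * j\<^sup>2) * conj_sum q (2 * j))"
      unfolding I_Suc(1) by (rule sum.union_disjoint) (use I_Suc in auto)
    ultimately show ?case using Suc by (simp add: a algebra_simps)
  qed
  obtain B where B: "\<And>L. norm (conj_sum q L) \<le> B" using conj_sum_bounded[OF assms(1)] by blast
  have B0: "B \<ge> 0" using B[of 0] norm_ge_zero order_trans by blast
  \<comment> \<open>Splitting \<open>q^(3N^2)\<close> as \<open>q^(N^2) * q^(2N^2)\<close>, the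
    first factor absorbs the growing negative powers in \<open>W (I N)\<close> and the second
    supplies decay.\<close>
  have bound: "norm (H N * W (I N)) \<le> norm P * B * (2 * (of_nat (Suc N) * norm q ^ N))" for N
  proof -
    have "norm (q ^ N\<^sup>2 * ((-1) powi j * q powi (- (j\<^sup>2)))) \<le> 1" if "j \<in> I N" for j
    proof -
      have "\<bar>j\<bar> \<le> \<bar>int N\<bar>" using that by (auto simp: I_def)
      then have "j\<^sup>2 \<le> (int N)\<^sup>2" by (simp only: abs_le_square_iff)
      then have "norm q powi ((int N)\<^sup>2 - j\<^sup>2) \<le> 1"
        using assms by (intro power_int_le_one) auto
      moreover have "norm (q ^ N\<^sup>2 * ((-1) powi j * q powi (- (j\<^sup>2)))) = norm q powi ((int N)\<^sup>2 - j\<^sup>2)"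
      proof -
        have "norm (q ^ N\<^sup>2 * ((-1) powi j * q powi (- (j\<^sup>2)))) = norm q powi int (N\<^sup>2) * norm q powi (- (j\<^sup>2))"
          by (simp only: norm_mult norm_power norm_power_int norm_minus_cancel norm_one
              power_int_1_left mult_1 power_int_of_nat)
        also have "\<dots> = norm q powi (int (N\<^sup>2) + (- (j\<^sup>2)))"
          by (rule power_int_add[symmetric]) (use assms(2) in auto)
        finally show ?thesis by simp
      qed
      ultimately show ?thesis by simp
    qed
    then have "norm (q ^ N\<^sup>2 * W (I N)) \<le> of_nat (card (I N)) * 1"
      unfolding W_def sum_distrib_left by (rule sum_norm_bound)
    also have "\<dots> \<le> 2 * of_nat (Suc N)" by (simp add: I_def)
    finally have W: "norm (q ^ N\<^sup>2 * W (I N)) \<le> 2 * of_nat (Suc N)" .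
    have HW: "H N * W (I N) = P * ((-1) ^ N * conj_sum q (2 * int N)) * (q ^ N\<^sup>2 * W (I N)) * q ^ (2 * N\<^sup>2)"
      by (simp add: H_def mult_ac flip: power_add)
    have "norm (H N * W (I N)) = norm P * norm (conj_sum q (2 * int N)) * norm (q ^ N\<^sup>2 * W (I N)) * norm q ^ (2 * N\<^sup>2)"
      unfolding HW by (simp add: norm_mult norm_power)
    also have "\<dots> \<le> norm P * B * (2 * of_nat (Suc N)) * norm q ^ N"
    proof (intro mult_mono W B mult_nonneg_nonneg power_decreasing)
      show "N \<le> 2 * N\<^sup>2" by (cases N) (auto simp: power2_eq_square)
    qed (use assms B0 in auto)
    finally show ?thesis by (simp add: algebra_simps)
  qed
  have "(\<lambda>N. of_nat (Suc N) * norm q ^ N) \<longlonglongrightarrow> 0"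
    by (rule summable_LIMSEQ_zero, rule sums_summable, rule geometric_deriv_sums) (use assms in auto)
  then have "(\<lambda>N. norm P * B * (2 * (of_nat (Suc N) * norm q ^ N))) \<longlonglongrightarrow> 0"
    by (rule tendsto_mult_right_zero[OF tendsto_mult_right_zero])
  then have "(\<lambda>N. H N * W (I N)) \<longlonglongrightarrow> 0"
    by (rule Lim_null_comparison[rotated]) (rule always_eventually, rule allI, rule bound)
  then have "(\<lambda>N. \<Sum>n<N. a n * W (I (Suc n))) \<longlonglongrightarrow> P * l - 0"
    unfolding parts using lim unfolding I_def by (intro tendsto_intros)
  then show ?thesis unfolding sums_def I_W a_def P_def by simp
qed

text \<open>At most \<open>2n + 1\<close> values of \<open>j\<close> contribute for a given
  \<open>n\<close>, so \<open>(n + 1) * norm q ^ n\<close> times a constant is a summable majorant,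
  uniform in \<open>N\<close>, and Tannery's theorem exchanges the sums.\<close>

lemma conj_sum_theta_tendsto:
  fixes q :: complex
  assumes "norm q < 1"
  shows "(\<lambda>N. \<Sum>j\<in>{-int N<..<int N}. q powi (2 * j\<^sup>2) * conj_sum q (2 * j)) \<longlonglongrightarrow>
    (\<Sum>n. \<Sum>j=-int n..int n. q powi (2 * j\<^sup>2) * conj_term q n (2 * j))"
proof -
  obtain K where K: "\<And>n L. norm (conj_term q n L) \<le> K * norm q ^ n" "K > 0"
    using conj_term_bounded[OF assms] by blast
  define t where "t n j = q powi (2 * j\<^sup>2) * conj_term q n (2 * j)" for n j
  have t0: "t n j = 0" if "int n < \<bar>j\<bar>" for n j
    using that by (simp add: t_def conj_term_eq_0)
  define a where "a n N = (\<Sum>j\<in>{-int N<..<int N}. t n j)" for n N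
  have lim: "a n \<longlonglongrightarrow> (\<Sum>j=-int n..int n. t n j)" for n
  proof (rule tendsto_eventually)
    show "\<forall>\<^sub>F N in sequentially. a n N = (\<Sum>j=-int n..int n. t n j)"
      using eventually_gt_at_top[of n]
    proof eventually_elim
      case (elim N)
      show ?case unfolding a_def
        by (rule sum.mono_neutral_right) (use elim in \<open>auto intro!: t0\<close>)
    qed
  qed
  have tb: "norm (t n j) \<le> K * norm q ^ n" for n j
  proof -
    have "norm (t n j) \<le> 1 * (K * norm q ^ n)"
      unfolding t_def norm_mult norm_power_int using assms K
      by (intro mult_mono power_int_le_one) auto
    then show ?thesis by simp
  qed
  have bound: "norm (a n N) \<le> 2 * K * (of_nat (Suc n) * norm q ^ n)" for n N
  proof -
    have "a n N = (\<Sum>j\<in>{-int N<..<int N} \<inter> {-int n..int n}. t n j)"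
      unfolding a_def by (rule sum.mono_neutral_right) (auto intro!: t0)
    also have "norm \<dots> \<le> of_nat (card ({-int N<..<int N} \<inter> {-int n..int n})) * (K * norm q ^ n)"
      by (rule sum_norm_bound) (rule tb)
    also have "\<dots> \<le> of_nat (2 * Suc n) * (K * norm q ^ n)"
    proof (intro mult_right_mono mult_nonneg_nonneg)
      have "card ({-int N<..<int N} \<inter> {-int n..int n}) \<le> card {-int n..int n}"
        by (intro card_mono) auto
      then show "real (card ({-int N<..<int N} \<inter> {-int n..int n})) \<le> of_nat (2 * Suc n)" by simp
    qed (use K in auto)
    finally show ?thesis by (simp add: algebra_simps)
  qed
  have sM: "summable (\<lambda>n. 2 * K * (of_nat (Suc n) * norm q ^ n))"
    by (intro summable_mult sums_summable[OF geometric_deriv_sums]) (use assms in auto)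
  have "\<forall>\<^sub>F (n, N) in sequentially \<times>\<^sub>F sequentially. norm (a n N) \<le> 2 * K * (of_nat (Suc n) * norm q ^ n)"
    using bound by (intro always_eventually) auto
  from tannerys_theorem[OF lim this sM trivial_limit_sequentially]
  have "(\<lambda>N. \<Sum>n. a n N) \<longlonglongrightarrow> (\<Sum>n. \<Sum>j=-int n..int n. t n j)"
    by blast
  also have "(\<lambda>N. \<Sum>n. a n N) = (\<lambda>N. \<Sum>j\<in>{-int N<..<int N}. q powi (2 * j\<^sup>2) * conj_sum q (2 * j))"
    unfolding a_def t_def conj_sum_def
    by (subst suminf_sum) (auto intro!: summable_mult summable_conj_term assms simp: suminf_mult summable_conj_term assms)
  finally show ?thesis unfolding t_def .
qed

section \<open>Holomorphy of $q$-Pochhammer symbols\<close>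

lemma norm_qpoch_le:
  assumes "norm a \<le> A" "norm q \<le> r"
  shows "norm (qpoch a q n) \<le> (\<Prod>j<n. 1 + A * r ^ j)"
  unfolding qpoch_def prod_norm[symmetric]
proof (rule prod_mono)
  fix j
  have "norm (1 - a * q ^ j) \<le> 1 + norm (a * q ^ j)"
    using norm_triangle_ineq4[of 1 "a * q ^ j"] by simp
  also have "norm (a * q ^ j) \<le> A * r ^ j"
    unfolding norm_mult norm_power using assms
    by (intro mult_mono power_mono) (auto intro: order_trans[OF norm_ge_zero])
  finally show "0 \<le> norm (1 - a * q ^ j) \<and> norm (1 - a * q ^ j) \<le> 1 + A * r ^ j" by simp
qed

text \<open>Factor by factor, the majorant is the real product \<open>(-1;r)_n\<close>, which
  converges.\<close>

lemma qpoch_uniformly_bounded: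
  fixes r :: real
  assumes "0 \<le> r" "r < 1"
  obtains B where "\<And>a q n. norm a \<le> 1 \<Longrightarrow> norm q \<le> r \<Longrightarrow> norm (qpoch a q n) \<le> B"
proof -
  have "Bseq (\<lambda>n. qpoch (-1) (of_real r) n)"
    by (rule convergent_imp_Bseq, rule convergentI, rule qpoch_tendsto) (use assms in auto)
  then obtain B where B: "\<And>n. norm (qpoch (-1) (of_real r) n) \<le> B"
    by (auto simp: Bseq_def)
  have eq: "norm (qpoch (-1) (of_real r) n) = (\<Prod>j<n. 1 + 1 * r ^ j)" for n
    unfolding qpoch_def prod_norm[symmetric]
  proof (rule prod.cong)
    fix j
    have "1 - (-1) * complex_of_real r ^ j = of_real (1 + r ^ j)" by simp
    then show "norm (1 - (-1) * complex_of_real r ^ j) = 1 + 1 * r ^ j"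
      using assms by (simp only: norm_of_real) simp
  qed simp
  have "norm (qpoch a q n) \<le> B" if "norm a \<le> 1" "norm q \<le> r" for a q n
    using norm_qpoch_le[OF that, of n] B[of n] unfolding eq by linarith
  then show ?thesis by (rule that)
qed

text \<open>Factor by factor, the modulus is smallest for \<open>a = q = r\<close>, and
  \<open>(r;r)_n\<close> has a nonzero limit.\<close>

lemma inverse_qpoch_uniformly_bounded:
  fixes r :: real
  assumes "0 \<le> r" "r < 1"
  obtains B where "\<And>a q n. norm a \<le> r \<Longrightarrow> norm q \<le> r \<Longrightarrow> norm (inverse (qpoch a q n)) \<le> B"
proof -
  have "(\<lambda>n. inverse (qpoch (of_real r) (of_real r) n)) \<longlonglongrightarrow> inverse (qpoch_inf (of_real r) (of_real r))"
    by (intro tendsto_inverse qpoch_tendsto qpoch_inf_nonzero) (use assms in auto)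
  then have "Bseq (\<lambda>n. inverse (qpoch (of_real r) (of_real r) n))"
    by (auto intro!: convergent_imp_Bseq convergentI)
  then obtain B where B: "\<And>n. norm (inverse (qpoch (of_real r) (of_real r) n)) \<le> B"
    by (auto simp: Bseq_def)
  have "norm (inverse (qpoch a q n)) \<le> B" if "norm a \<le> r" "norm q \<le> r" for a q n
  proof -
    have "norm (inverse (qpoch a q n)) \<le> norm (inverse (qpoch (of_real r) (of_real r) n))"
      unfolding norm_inverse
    proof (rule le_imp_inverse_le)
      show "norm (qpoch (of_real r) (of_real r) n) \<le> norm (qpoch a q n)"
        unfolding qpoch_def prod_norm[symmetric]
      proof (rule prod_mono)
        fix j
        have "r * r ^ j \<le> 1 * 1" using assms by (intro mult_mono power_le_one) auto
        moreover have "1 - complex_of_real r * complex_of_real r ^ j = of_real (1 - r * r ^ j)" by simp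
        ultimately have "norm (1 - complex_of_real r * complex_of_real r ^ j) = 1 - r * r ^ j"
          by (simp only: norm_of_real)
        also have "\<dots> \<le> 1 - norm (a * q ^ j)"
          unfolding norm_mult norm_power using that assms
          by (intro diff_left_mono mult_mono power_mono) auto
        also have "\<dots> \<le> norm (1 - a * q ^ j)"
          using norm_triangle_ineq2[of 1 "a * q ^ j"] by simp
        finally show "0 \<le> norm (1 - complex_of_real r * complex_of_real r ^ j) \<and>
          norm (1 - complex_of_real r * complex_of_real r ^ j) \<le> norm (1 - a * q ^ j)" by simp
      qed
      show "0 < norm (qpoch (of_real r) (of_real r) n)"
        using qpoch_nonzero[of "of_real r" "of_real r"] assms by simp
    qed
    with B show ?thesis by (rule order_trans[rotated])
  qed
  then show ?thesis by (rule that)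
qed

lemma norm_power_less_one: "norm (x::complex) < 1 \<Longrightarrow> n > 0 \<Longrightarrow> norm (x ^ n) < 1"
  by (simp add: norm_power power_less_one_iff)

text \<open>The partial products are polynomials and converge uniformly on closed discs: there the
  factors differ from 1 by at most \<open>r^n\<close>, with \<open>r < 1\<close> the maximal modulus
  on the disc.\<close>

lemma holomorphic_qpoch_inf:
  assumes "k > 0"
  shows "(\<lambda>x. qpoch_inf (x ^ k) (x ^ k)) holomorphic_on ball 0 1"
proof (rule holomorphic_uniform_sequence)
  show "open (ball 0 1 :: complex set)" by simp
  show "(\<lambda>x. qpoch (x ^ k) (x ^ k) n) holomorphic_on ball 0 1" for n
    unfolding qpoch_def by (intro holomorphic_intros)
  fix x :: complex
  assume "x \<in> ball 0 1"
  then obtain d where d: "d > 0" "cball x d \<subseteq> ball 0 1"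
    using open_contains_cball open_ball by metis
  have "compact (norm ` cball x d)" by (intro compact_continuous_image continuous_intros) auto
  then obtain y where y: "y \<in> cball x d" "\<And>z. z \<in> cball x d \<Longrightarrow> norm z \<le> norm y"
    using compact_attains_sup[of "norm ` cball x d"] d(1) by fastforce
  define r where "r = norm y"
  have r: "0 \<le> r" "r < 1" using y d by (auto simp: r_def)
  have "uniformly_convergent_on (cball x d) (\<lambda>N z. \<Prod>n<N. 1 + (- (z ^ k * (z ^ k) ^ n)))"
  proof (rule uniformly_convergent_on_prod)
    show "uniformly_convergent_on (cball x d) (\<lambda>N z. \<Sum>n<N. norm (- (z ^ k * (z ^ k) ^ n)))"
    proof (rule Weierstrass_m_test_ev[THEN uniformly_convergentI])
      show "summable (\<lambda>n. r ^ n)" using r by (intro summable_geometric) auto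
      have "norm (norm (- (z ^ k * (z ^ k) ^ n))) \<le> r ^ n" if "z \<in> cball x d" for n z
      proof -
        have z: "norm z \<le> r" using y(2)[OF that] by (simp add: r_def)
        have "n \<le> k + k * n" using assms by (simp add: trans_le_add2)
        then have "norm z ^ (k + k * n) \<le> r ^ n"
          using z r by (intro order_trans[OF power_decreasing[of n] power_mono]) auto
        then show ?thesis by (simp add: norm_mult norm_power power_add power_mult)
      qed
      then show "\<forall>\<^sub>F n in sequentially. \<forall>z\<in>cball x d. norm (norm (- (z ^ k * (z ^ k) ^ n))) \<le> r ^ n"
        by simp
    qed
  qed (auto intro!: continuous_intros)
  then have "uniformly_convergent_on (cball x d) (\<lambda>N z. qpoch (z ^ k) (z ^ k) N)"
    by (simp add: qpoch_def)
  then obtain g where g: "uniform_limit (cball x d) (\<lambda>N z. qpoch (z ^ k) (z ^ k) N) g sequentially"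
    by (auto simp: uniformly_convergent_on_def)
  have "g z = qpoch_inf (z ^ k) (z ^ k)" if "z \<in> cball x d" for z
  proof (rule LIMSEQ_unique)
    show "(\<lambda>N. qpoch (z ^ k) (z ^ k) N) \<longlonglongrightarrow> g z" by (rule tendsto_uniform_limitI[OF g that])
    have "norm z < 1" using that d by auto
    then show "(\<lambda>N. qpoch (z ^ k) (z ^ k) N) \<longlonglongrightarrow> qpoch_inf (z ^ k) (z ^ k)"
      by (intro qpoch_tendsto norm_power_less_one assms)
  qed
  then have "uniform_limit (cball x d) (\<lambda>N z. qpoch (z ^ k) (z ^ k) N) (\<lambda>z. qpoch_inf (z ^ k) (z ^ k)) sequentially"
    by (rule uniform_limit_cong'[THEN iffD1, OF refl _ g])
  then show "\<exists>d>0. cball x d \<subseteq> ball 0 1 \<and>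
      uniform_limit (cball x d) (\<lambda>N z. qpoch (z ^ k) (z ^ k) N) (\<lambda>z. qpoch_inf (z ^ k) (z ^ k)) sequentially"
    using d by blast
qed

section \<open>The even part of $S$\<close>

definition S_term :: "nat \<Rightarrow> complex \<Rightarrow> complex" where
  "S_term n x = (qpoch x (x\<^sup>2) n)\<^sup>2 * x ^ (2 * n) / qpoch (- (x\<^sup>2)) (x\<^sup>2) n"

text \<open>The Pochhammer factors are bounded uniformly on the disc, and \<open>x^(2n)\<close>
  gives the decay. The bound serves both summability and the Weierstrass test.\<close>

lemma S_term_bound:
  fixes r :: real
  assumes "0 \<le> r" "r < 1"
  obtains B where "\<And>x n. norm x \<le> r \<Longrightarrow> norm (S_term n x) \<le> B * r ^ n"
proof -
  obtain C where C: "\<And>a q n. norm a \<le> 1 \<Longrightarrow> norm q \<le> r \<Longrightarrow> norm (qpoch a q n) \<le> C"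
    using qpoch_uniformly_bounded[OF assms] by metis
  obtain E where E: "\<And>a q n. norm a \<le> r \<Longrightarrow> norm q \<le> r \<Longrightarrow> norm (inverse (qpoch a q n)) \<le> E"
    using inverse_qpoch_uniformly_bounded[OF assms] by metis
  have C0: "C \<ge> 0" using C[of 0 0 0] assms by simp
  have "norm (S_term n x) \<le> (C\<^sup>2 * E) * r ^ n" if x: "norm x \<le> r" for x n
  proof -
    have x2: "norm (x\<^sup>2) \<le> r"
      using mult_mono[OF x, of "norm x" 1] x assms by (simp add: norm_mult power2_eq_square)
    have "norm (S_term n x) = (norm (qpoch x (x\<^sup>2) n))\<^sup>2 * norm (inverse (qpoch (- (x\<^sup>2)) (x\<^sup>2) n)) * norm x ^ (2 * n)"
      by (simp add: S_term_def norm_mult norm_divide norm_power norm_inverse field_simps)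
    also have "\<dots> \<le> C\<^sup>2 * E * r ^ n"
    proof (intro mult_mono power_mono C E)
      show "norm x ^ (2 * n) \<le> r ^ n"
        using x assms by (intro order_trans[OF power_decreasing[of n] power_mono]) auto
      show "0 \<le> C\<^sup>2 * E"
        using C0 order_trans[OF norm_ge_zero E[of 0 0 0]] assms by simp
    qed (use x x2 assms C0 in auto)
    finally show ?thesis .
  qed
  then show ?thesis by (rule that)
qed

lemma S_term_summable:
  assumes "norm x < 1"
  shows "summable (\<lambda>n. S_term n x)"
proof -
  obtain B where "\<And>n. norm (S_term n x) \<le> B * norm x ^ n"
    using S_term_bound[of "norm x"] assms by (metis norm_ge_zero order_refl)
  then show ?thesis
    by (rule summable_comparison_test'[rotated]) (use assms in \<open>auto intro!: summable_mult summable_geometric\<close>)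
qed

lemma S_series_altdef: "S_series x = (\<Sum>n. S_term n x)"
  by (simp add: S_series_def S_term_def)

text \<open>Needed because \<open>sieve\<close> reads its coefficients off derivatives at 0.\<close>

lemma holomorphic_S_series: "S_series holomorphic_on ball 0 1"
proof (rule holomorphic_uniform_sequence)
  show "open (ball 0 1 :: complex set)" by simp
  have "S_term n holomorphic_on ball 0 1" for n
  proof -
    have "qpoch (- (x\<^sup>2)) (x\<^sup>2) n \<noteq> 0" if "x \<in> ball 0 1" for x
      using that by (intro qpoch_nonzero) (auto simp: norm_power power_less_one_iff)
    then show ?thesis
      unfolding S_term_def[abs_def] qpoch_def by (intro holomorphic_intros) auto
  qed
  then show "(\<lambda>x. \<Sum>n<N. S_term n x) holomorphic_on ball 0 1" for N
    by (intro holomorphic_intros)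
  fix x :: complex
  assume "x \<in> ball 0 1"
  then obtain d where d: "d > 0" "cball x d \<subseteq> ball 0 1"
    using open_contains_cball open_ball by metis
  have "compact (norm ` cball x d)" by (intro compact_continuous_image continuous_intros) auto
  then obtain y where y: "y \<in> cball x d" "\<And>z. z \<in> cball x d \<Longrightarrow> norm z \<le> norm y"
    using compact_attains_sup[of "norm ` cball x d"] d(1) by fastforce
  have r: "norm y < 1" using y d by auto
  obtain B where B: "\<And>x n. norm x \<le> norm y \<Longrightarrow> norm (S_term n x) \<le> B * norm y ^ n"
    using S_term_bound[of "norm y"] r by (metis norm_ge_zero)
  have "uniform_limit (cball x d) (\<lambda>N z. \<Sum>n<N. S_term n z) (\<lambda>z. \<Sum>n. S_term n z) sequentially"
    by (rule Weierstrass_m_test[of _ _ "\<lambda>n. B * norm y ^ n"])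
       (use B y r in \<open>auto intro!: summable_mult summable_geometric\<close>)
  then show "\<exists>d>0. cball x d \<subseteq> ball 0 1 \<and>
      uniform_limit (cball x d) (\<lambda>N z. \<Sum>n<N. S_term n z) S_series sequentially"
    using d unfolding S_series_altdef[abs_def] by blast
qed

text \<open>Averaging the Taylor series at \<open>q\<close> and \<open>- q\<close> removes the odd
  coefficients.\<close>

lemma sieve_2_0:
  assumes "f holomorphic_on ball 0 1" "norm q < 1"
  shows "sieve 2 0 f q = (f q + f (- q)) / 2"
proof -
  have "(\<lambda>n. (deriv ^^ n) f 0 / fact n * (q - 0) ^ n) sums f q"
       "(\<lambda>n. (deriv ^^ n) f 0 / fact n * (- q - 0) ^ n) sums f (- q)"
    using assms by (intro holomorphic_power_series[OF assms(1)]; simp)+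
  then have "(\<lambda>n. ((deriv ^^ n) f 0 / fact n * (q - 0) ^ n + (deriv ^^ n) f 0 / fact n * (- q - 0) ^ n) / 2)
     sums ((f q + f (- q)) / 2)"
    by (intro sums_divide sums_add)
  moreover have "((deriv ^^ n) f 0 / fact n * (q - 0) ^ n + (deriv ^^ n) f 0 / fact n * (- q - 0) ^ n) / 2 =
     (if int n mod int 2 = 0 mod int 2 then (deriv ^^ n) f 0 / fact n * q ^ n else 0)" for n
  proof (cases "even n")
    case True
    then have "int n mod 2 = 0" by simp
    with True show ?thesis by simp
  next
    case False
    then have "int n mod 2 = 1" by presburger
    with False show ?thesis by simp
  qed
  ultimately show ?thesis unfolding sieve_def by (simp add: sums_iff)
qed

section \<open>Parity splitting of the terms of \<open>S\<close>\<close>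

lemma jtp_coeff_minus [simp]: "jtp_coeff (- q) n j = jtp_coeff q n j"
  by (simp add: jtp_coeff_def)

lemma S_term_even_part:
  assumes "norm x < 1" "x \<noteq> 0"
  shows "(S_term n x + S_term n (- x)) / 2 =
    (\<Sum>j=-int n..int n. (x\<^sup>2) powi (2 * j\<^sup>2) * conj_term (x\<^sup>2) n (2 * j))"
proof -
  \<comment> \<open>With this cutoff the even indices in \<open>{-M..M}\<close> are exactly
    \<open>2 * i\<close> with \<open>\<bar>i\<bar> \<le> n\<close>.\<close>
  define M where "M = 2 * int n"
  define g where "g j = x powi (j\<^sup>2) * jtp_coeff x n j" for j
  have sq: "(qpoch y (y\<^sup>2) n)\<^sup>2 = (\<Sum>j=-M..M. (-1) powi j * y powi (j\<^sup>2) * jtp_coeff y n j)"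
    if "y = x \<or> y = - x" for y
    by (rule finite_jacobi_triple_product_1) (use that assms in \<open>auto simp: M_def\<close>)
  \<comment> \<open>As \<open>j^2\<close> has the parity of \<open>j\<close>, the expansion at
    \<open>- x\<close> loses its alternating sign, and the average carries the even-index indicator
    \<open>((-1) powi j + 1) / 2\<close>.\<close>
  have sgn: "(-1) powi j * ((- x) powi (j\<^sup>2)) = x powi (j\<^sup>2)" for j
  proof -
    have "(- x) powi (j\<^sup>2) = (-1) powi j * x powi (j\<^sup>2)"
      by (cases "even j") (auto simp: power_int_minus_left)
    moreover have "(-1) powi j * (-1) powi j = (1::complex)"
      by (cases "even j") (auto simp: power_int_minus_left)
    ultimately show ?thesis by (simp flip: mult.assoc)
  qed
  have "((qpoch x (x\<^sup>2) n)\<^sup>2 + (qpoch (- x) (x\<^sup>2) n)\<^sup>2) / 2 = (\<Sum>j=-M..M. ((-1) powi j + 1) / 2 * g j)"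
    using sq[of x] sq[of "-x"]
    by (simp add: sgn g_def add_divide_distrib sum_divide_distrib sum.distrib algebra_simps)
  also have "\<dots> = (\<Sum>j\<in>(*) 2 ` {-int n..int n}. ((-1) powi j + 1) / 2 * g j)"
  proof (rule sum.mono_neutral_right)
    show "\<forall>j\<in>{-M..M} - (*) 2 ` {-int n..int n}. ((-1) powi j + 1) / 2 * g j = 0"
    proof
      fix j assume j: "j \<in> {-M..M} - (*) 2 ` {-int n..int n}"
      have "odd j"
      proof
        assume "even j"
        then obtain i where "j = 2 * i" by blast
        with j show False by (auto simp: M_def)
      qed
      then show "((-1) powi j + 1) / 2 * g j = 0" by (simp add: power_int_minus_left)
    qed
  qed (auto simp: M_def)
  also have "\<dots> = (\<Sum>j=-int n..int n. g (2 * j))"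
    by (subst sum.reindex) (auto simp: inj_on_def power_int_minus_left)
  finally have *: "((qpoch x (x\<^sup>2) n)\<^sup>2 + (qpoch (- x) (x\<^sup>2) n)\<^sup>2) / 2 = (\<Sum>j=-int n..int n. g (2 * j))" .
  have "(S_term n x + S_term n (- x)) / 2 =
    x ^ (2 * n) / qpoch (- (x\<^sup>2)) (x\<^sup>2) n * (((qpoch x (x\<^sup>2) n)\<^sup>2 + (qpoch (- x) (x\<^sup>2) n)\<^sup>2) / 2)"
    by (simp add: S_term_def add_divide_distrib algebra_simps)
  also have "\<dots> = (\<Sum>j=-int n..int n. x powi ((2 * j)\<^sup>2) *
      (x ^ (2 * n) / qpoch (- (x\<^sup>2)) (x\<^sup>2) n * jtp_coeff x n (2 * j)))"
    unfolding * g_def sum_distrib_left by (simp add: mult_ac)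
  also have "\<dots> = (\<Sum>j=-int n..int n. (x\<^sup>2) powi (2 * j\<^sup>2) * conj_term (x\<^sup>2) n (2 * j))"
  proof (rule sum.cong)
    fix j
    have "x powi ((2 * j)\<^sup>2) = (x\<^sup>2) powi (2 * j\<^sup>2)"
    proof -
      have "(x\<^sup>2) powi (2 * j\<^sup>2) = x powi (2 * (2 * j\<^sup>2))"
        by (metis of_nat_numeral power_int_mult power_int_of_nat)
      then show ?thesis by (simp add: power_mult_distrib)
    qed
    then show "x powi ((2 * j)\<^sup>2) * (x ^ (2 * n) / qpoch (- (x\<^sup>2)) (x\<^sup>2) n * jtp_coeff x n (2 * j)) =
       (x\<^sup>2) powi (2 * j\<^sup>2) * conj_term (x\<^sup>2) n (2 * j)"
      by (simp only: conj_term_jtp_coeff[OF assms(1)])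
  qed simp
  finally show ?thesis .
qed

theorem theorem1p2:
  fixes q :: complex
  assumes "norm q < 1"
  shows "sieve 2 0 (\<lambda>x. qpoch_inf (x^4) (x^4) * S_series x) q =
    (\<Sum>n. (-1)^n * q^(6*n^2 + 4*n) * (1 + q^(4*n+2)) *
       (\<Sum>j\<in>{-int n..int n}. (-1) powi j * q powi (-2 * j^2)))"
proof -
  have "(\<lambda>x. qpoch_inf (x ^ 4) (x ^ 4) * S_series x) holomorphic_on ball 0 1"
    by (intro holomorphic_on_mult holomorphic_qpoch_inf holomorphic_S_series) simp
  from sieve_2_0[OF this assms]
  \<comment> \<open>The prefactor depends only on \<open>x^4\<close>, so it is even and leaves the
    average.\<close>
  have sieve: "sieve 2 0 (\<lambda>x. qpoch_inf (x^4) (x^4) * S_series x) q =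
      qpoch_inf (q ^ 4) (q ^ 4) * ((S_series q + S_series (- q)) / 2)"
    by (simp add: algebra_simps add_divide_distrib)
  show ?thesis
  proof (cases "q = 0")
    \<comment> \<open>Both sides are 1 at \<open>q = 0\<close>: for \<open>n > 0\<close> the power
      \<open>q^(6n^2 + 4n)\<close> vanishes, whatever value \<open>powi\<close> gives to 0 at
      negative exponents.\<close>
    case True
    have "S_series 0 = 1"
    proof -
      have "(\<Sum>n. S_term n 0) = (\<Sum>n\<in>{0}. S_term n 0)"
        by (rule suminf_finite) (auto simp: S_term_def)
      then show ?thesis by (simp add: S_series_altdef S_term_def)
    qed
    moreover have "qpoch_inf 0 0 = 1" by (simp add: qpoch_inf_def)
    moreover have "(\<Sum>n. (-1)^n * q^(6*n^2 + 4*n) * (1 + q^(4*n+2)) *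
       (\<Sum>j\<in>{-int n..int n}. (-1) powi j * q powi (-2 * j^2))) =
       (\<Sum>n\<in>{0}. (-1)^n * q^(6*n^2 + 4*n) * (1 + q^(4*n+2)) *
       (\<Sum>j\<in>{-int n..int n}. (-1) powi j * q powi (-2 * j^2)))"
      by (rule suminf_finite) (auto simp: True)
    ultimately show ?thesis unfolding sieve by (simp add: True)
  next
    case False
    define Q where "Q = q\<^sup>2"
    have Q: "norm Q < 1" "Q \<noteq> 0" using assms False by (auto simp: Q_def norm_power power_less_one_iff)
    define l where "l = (\<Sum>n. \<Sum>j=-int n..int n. Q powi (2 * j\<^sup>2) * conj_term Q n (2 * j))"
    have "(\<lambda>n. (S_term n q + S_term n (- q)) / 2) sums ((S_series q + S_series (- q)) / 2)"
      unfolding S_series_altdef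
      by (intro sums_divide sums_add summable_sums S_term_summable) (use assms in auto)
    then have "(S_series q + S_series (- q)) / 2 = l"
      unfolding S_term_even_part[OF assms False] l_def Q_def by (simp add: sums_iff)
    moreover have "(\<lambda>n. (-1) ^ n * Q ^ (3 * n\<^sup>2 + 2 * n) * (1 + Q ^ (2 * n + 1)) *
       (\<Sum>j=-int n..int n. (-1) powi j * Q powi (- (j\<^sup>2)))) sums (qpoch_inf (Q\<^sup>2) (Q\<^sup>2) * l)"
      unfolding l_def by (intro indefinite_theta_sums conj_sum_theta_tendsto Q)
    moreover have "Q powi (- (j\<^sup>2)) = q powi (-2 * j\<^sup>2)" for j :: int
    proof -
      have "(q\<^sup>2) powi (- (j\<^sup>2)) = q powi (2 * (- (j\<^sup>2)))"
        by (metis of_nat_numeral power_int_mult power_int_of_nat)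
      then show ?thesis by (simp add: Q_def)
    qed
    moreover have "Q ^ (3 * n\<^sup>2 + 2 * n) = q ^ (6 * n\<^sup>2 + 4 * n)" "Q ^ (2 * n + 1) = q ^ (4 * n + 2)" for n
    proof -
      have "Q ^ m = q ^ (2 * m)" for m by (simp add: Q_def power_mult)
      from this[of "3 * n\<^sup>2 + 2 * n"] this[of "2 * n + 1"]
      show "Q ^ (3 * n\<^sup>2 + 2 * n) = q ^ (6 * n\<^sup>2 + 4 * n)" "Q ^ (2 * n + 1) = q ^ (4 * n + 2)"
        by (simp_all add: distrib_left)
    qed
    moreover have "Q\<^sup>2 = q ^ 4" by (simp add: Q_def flip: power_mult)
    ultimately show ?thesis unfolding sieve by (simp only: sums_iff)
  qed
qed

end
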